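(* Let $k > \ell \geq 1$ be integers and let $e_1,\ldots,e_t$ be positive integers. Then \[ R_<\big(P_{e_1}^{k,\ell},\ldots,P_{e_t}^{k,\ell}\big)=(k-\ell)\,\big|Q_{i(k,\ell)}(e_1,\dots,e_t)\big|+\ell-(k-\ell)\big(i(k,\ell)-2\big). \]
   Context: An ordered $k$-uniform hypergraph is a $k$-uniform hypergraph with a totally ordered vertex set. An ordered hypergraph $G$ is contained in an ordered hypergraph $H$ if there is an injective order-preserving map $V(G)\to V(H)$ sending every edge of $G$ to an edge of $H$. $K_N^k$ is the complete $k$-uniform hypergraph on $[N]=\{1,\dots,N\}$ with the natural order. For ordered $k$-uniform hypergraphs $G_1,\dots,G_t$, the ordered Ramsey number $R_<(G_1,\dots,G_t)$ is the least $N$ such that for every coloring $c:E(K_N^k)\to[t]$ there is a color $j$ such that the hypergraph formed by the edges of color $j$ contains $G_j$. For integers $k>\ell\ge 0$ and $e\ge1$, the path $P_e^{k,\ell}$ is the ordered $k$-uniform hypergraph on vertex set $[e(k-\ell)+\ell]$ with edges $A_r=\{(r-1)(k-\ell)+1,\dots,(r-1)(k-\ell)+k\}$ for $r=1,\dots,e$. For $k>\ell\ge1$, $i(k,\ell)$ is the unique integer $m\ge2$ with $\frac{m-2}{m-1}<\frac{\ell}{k}\le\frac{m-1}{m}$. For a poset $P$, a down-set is a subset $S\subseteq P$ such that $y\in S$ and $x\le y$ imply $x\in S$; $J(P)$ denotes the poset of all down-sets of $P$ ordered by inclusion. The poset $Q_1(e_1,\dots,e_t)$ is the disjoint union of $t$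 chains of sizes $e_1-1,\dots,e_t-1$ (elements in different chains incomparable), and $Q_{m+1}(e_1,\dots,e_t)=J(Q_m(e_1,\dots,e_t))$ for $m\ge1$. *)

theory Defs
  imports Complex_Main "HOL-Library.Ramsey" "HOL-Library.FSet"
begin

record 'a hypergraph =
  verts :: "'a set"
  edges :: "'a set set"

text \<open>The order on the vertices is the one of the linearly ordered vertex type.\<close>

definition uniform_hypergraph :: "nat \<Rightarrow> 'a::linorder hypergraph \<Rightarrow> bool" where
  "uniform_hypergraph k G \<longleftrightarrow> edges G \<subseteq> nsets (verts G) k"

definition contained_in :: "'a::linorder hypergraph \<Rightarrow> 'b::linorder hypergraph \<Rightarrow> bool" where
  "contained_in G H \<longleftrightarrow>
     (\<exists>f. f \<in> verts G \<rightarrow> verts H \<and> inj_on f (verts G) \<and> mono_on (verts G) f \<and>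
          (\<forall>A\<in>edges G. f ` A \<in> edges H))"

definition complete_hypergraph :: "nat \<Rightarrow> nat \<Rightarrow> nat hypergraph" where
  "complete_hypergraph k N = \<lparr>verts = {1..N}, edges = nsets {1..N} k\<rparr>"

definition color_class :: "nat hypergraph \<Rightarrow> (nat set \<Rightarrow> nat) \<Rightarrow> nat \<Rightarrow> nat hypergraph" where
  "color_class H c j = \<lparr>verts = verts H, edges = {A \<in> edges H. c A = j}\<rparr>"

definition ordered_ramsey_number ::
    "nat \<Rightarrow> nat \<Rightarrow> (nat \<Rightarrow> 'a::linorder hypergraph) \<Rightarrow> nat" where
  "ordered_ramsey_number k t G =
     (LEAST N. \<forall>c \<in> edges (complete_hypergraph k N) \<rightarrow> {1..t}.
        \<exists>j\<in>{1..t}. contained_in (G j) (color_class (complete_hypergraph k N) c j))"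

definition path_edge :: "nat \<Rightarrow> nat \<Rightarrow> nat \<Rightarrow> nat set" where
  "path_edge k l r = {(r - 1) * (k - l) + 1..(r - 1) * (k - l) + k}"

definition path_hypergraph :: "nat \<Rightarrow> nat \<Rightarrow> nat \<Rightarrow> nat hypergraph" where
  "path_hypergraph k l e =
     \<lparr>verts = {1..e * (k - l) + l}, edges = path_edge k l ` {1..e}\<rparr>"

definition path_index :: "nat \<Rightarrow> nat \<Rightarrow> nat" where
  "path_index k l =
     (THE m. 2 \<le> m \<and> (real m - 2) / (real m - 1) < real l / real k
                  \<and> real l / real k \<le> (real m - 1) / real m)"

text \<open>A poset is given by its reflexive order relation \<open>r\<close>; its set of elements is \<open>Field r\<close>.\<close>

definition down_sets :: "'a rel \<Rightarrow> 'a set set" where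
  "down_sets r = {S. S \<subseteq> Field r \<and> (\<forall>x y. y \<in> S \<longrightarrow> (x, y) \<in> r \<longrightarrow> x \<in> S)}"

definition down_set_poset :: "'a rel \<Rightarrow> 'a set rel" where
  "down_set_poset r = {(S, T). S \<in> down_sets r \<and> T \<in> down_sets r \<and> S \<subseteq> T}"

text \<open>
  Forming the poset of down-sets raises the type of the elements from \<open>'a\<close> to \<open>'a set\<close>, so it
  cannot be iterated a variable number of times as it stands. The following type contains the
  elements of the initial disjoint union of chains (\<open>Chain i a\<close> is the \<open>a\<close>-th element of the
  \<open>i\<close>-th chain) and is closed under forming finite sets. All posets involved are finite, so
  \<open>J\<close> below is, up to the injective tagging \<open>Down\<close>, exactly \<open>down_set_poset\<close>; see
  \<open>J_eq_down_set_poset\<close> and \<open>finite_Q\<close>.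
\<close>

datatype node = Chain nat nat | Down "node fset"

definition J :: "node rel \<Rightarrow> node rel" where
  "J r = {(Down A, Down B) | A B. (fset A, fset B) \<in> down_set_poset r}"

definition disjoint_chains :: "nat \<Rightarrow> (nat \<Rightarrow> nat) \<Rightarrow> node rel" where
  "disjoint_chains t e = {(Chain i a, Chain i b) | i a b. i \<in> {1..t} \<and> 1 \<le> a \<and> a \<le> b \<and> b \<le> e i - 1}"

definition Q :: "nat \<Rightarrow> nat \<Rightarrow> (nat \<Rightarrow> nat) \<Rightarrow> node rel" where
  "Q m t e = (J ^^ (m - 1)) (disjoint_chains t e)"

lemma Q_1: "Q 1 t e = disjoint_chains t e"
  by (simp add: Q_def)

lemma Q_Suc: "1 \<le> m \<Longrightarrow> Q (m + 1) t e = J (Q m t e)"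
  by (cases m) (simp_all add: Q_def)

lemma Field_down_set_poset: "Field (down_set_poset r) = down_sets r"
  by (auto simp: Field_def down_set_poset_def)

lemma J_eq_down_set_poset:
  assumes "finite (Field r)"
  shows "J r = map_prod (Down \<circ> Abs_fset) (Down \<circ> Abs_fset) ` down_set_poset r"
    and "inj_on (Down \<circ> Abs_fset) (Field (down_set_poset r))"
proof -
  have fin: "finite S" if "S \<in> down_sets r" for S
    using that assms by (auto simp: down_sets_def intro: finite_subset)
  show "J r = map_prod (Down \<circ> Abs_fset) (Down \<circ> Abs_fset) ` down_set_poset r"
  proof (intro equalityI subsetI)
    fix p assume "p \<in> J r"
    then obtain A B where "p = (Down A, Down B)" "(fset A, fset B) \<in> down_set_poset r"
      by (auto simp: J_def)
    then show "p \<in> map_prod (Down \<circ> Abs_fset) (Down \<circ> Abs_fset) ` down_set_poset r"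
      by (intro image_eqI[where x = "(fset A, fset B)"]) (simp_all add: fset_inverse)
  next
    fix p assume "p \<in> map_prod (Down \<circ> Abs_fset) (Down \<circ> Abs_fset) ` down_set_poset r"
    then obtain S T where "p = (Down (Abs_fset S), Down (Abs_fset T))"
      and ST: "(S, T) \<in> down_set_poset r" by auto
    moreover have "fset (Abs_fset S) = S" "fset (Abs_fset T) = T"
      using ST fin by (auto simp: down_set_poset_def Abs_fset_inverse)
    ultimately show "p \<in> J r" unfolding J_def by force
  qed
  show "inj_on (Down \<circ> Abs_fset) (Field (down_set_poset r))"
    using fin by (auto simp: inj_on_def Field_down_set_poset Abs_fset_inject)
qed

lemma finite_J: "finite r \<Longrightarrow> finite (J r)"
proof -
  assume "finite r"
  then have F: "finite (Field r)" by (rule finite_Field)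
  have "down_set_poset r \<subseteq> Pow (Field r) \<times> Pow (Field r)"
    by (auto simp: down_set_poset_def down_sets_def)
  then have "finite (down_set_poset r)"
    using F by (meson finite_Pow_iff finite_SigmaI finite_subset)
  then show ?thesis by (simp add: J_eq_down_set_poset[OF F])
qed

lemma finite_disjoint_chains: "finite (disjoint_chains t e)"
proof (rule finite_subset)
  show "disjoint_chains t e \<subseteq>
      (\<Union>i\<in>{1..t}. (Chain i ` {..e i}) \<times> (Chain i ` {..e i}))"
    by (force simp: disjoint_chains_def)
qed simp

lemma finite_Q: "finite (Q m t e)"
proof -
  have "finite ((J ^^ n) (disjoint_chains t e))" for n
    by (induction n) (simp_all add: finite_disjoint_chains finite_J)
  then show ?thesis by (simp add: Q_def)
qed

lemma Partial_order_J: "Partial_order (J r)"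
  by (auto simp: order_on_defs refl_on_def trans_def antisym_def J_def down_set_poset_def Field_def
      fset_inject)

lemma Partial_order_disjoint_chains: "Partial_order (disjoint_chains t e)"
proof -
  have "refl_on (Field (disjoint_chains t e)) (disjoint_chains t e)"
    unfolding refl_on_def Field_def disjoint_chains_def by force
  moreover have "trans (disjoint_chains t e)" "antisym (disjoint_chains t e)"
    by (auto simp: trans_def antisym_def disjoint_chains_def)
  moreover have "disjoint_chains t e \<subseteq> Field (disjoint_chains t e) \<times> Field (disjoint_chains t e)"
    by (auto intro: FieldI1 FieldI2)
  ultimately show ?thesis by (simp add: order_on_defs)
qed

lemma Partial_order_Q: "Partial_order (Q m t e)"
  unfolding Q_def by (cases "m - 1") (simp_all add: Partial_order_disjoint_chains Partial_order_J)

lemma uniform_complete_hypergraph: "uniform_hypergraph k (complete_hypergraph k N)"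
  by (simp add: uniform_hypergraph_def complete_hypergraph_def)

lemma uniform_path_hypergraph:
  assumes "l < k"
  shows "uniform_hypergraph k (path_hypergraph k l e)"
proof -
  have "path_edge k l r \<in> nsets {1..e * (k - l) + l} k" if r: "r \<in> {1..e}" for r
  proof -
    have "(r - 1) * (k - l) + k = r * (k - l) + l"
      using r assms by (cases r) auto
    also have "\<dots> \<le> e * (k - l) + l" using r by simp
    finally show ?thesis by (auto simp: nsets_def path_edge_def)
  qed
  then show ?thesis by (auto simp: uniform_hypergraph_def path_hypergraph_def)
qed

end

theory Submission imports Defs begin

text \<open>
  Put \<open>d = k - l\<close> and \<open>k = (m - 1) d + s\<close> with \<open>1 \<le> s \<le> d\<close>; then \<open>m\<close> is the path index and the
  claim is that the Ramsey number is \<open>d |Q\<^sub>m| + s\<close>. Replacing vertices by blocks of \<open>d\<close> vertices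
  (the last one truncated to \<open>s\<close>) turns a tight \<open>m\<close>-uniform path into a path \<open>P\<^sup>k\<^sup>,\<^sup>l\<close>; conversely,
  taking the vertices of a path at positions \<open>s, s + d, s + 2d, \<dots>\<close> and rounding to multiples of
  \<open>d\<close> gives a tight path. So it suffices to show that the \<open>m\<close>-subsets of \<open>[N]\<close> can be coloured
  without long monochromatic tight paths iff \<open>N \<le> |Q\<^sub>m|\<close>.

  For a poset \<open>P\<close> let \<open>D(P)\<close> be the digraph with arcs \<open>x \<rightarrow> y\<close> whenever \<open>y \<le> x\<close> fails. Recording the
  colour of a set and the length of the longest monochromatic tight path ending in it, a good
  colouring is the same as a homomorphism to \<open>D(Q\<^sub>1)\<close> from the shift graph on \<open>m\<close>-sets. The shift
  graph on \<open>(n+1)\<close>-sets is the line digraph of the one on \<open>n\<close>-sets, and a line digraph \<open>L(G)\<close> maps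
  to \<open>D(P)\<close> iff \<open>G\<close> maps to \<open>D(J(P))\<close>. Iterating leads to the transitive tournament on \<open>N\<close>
  vertices, which maps to \<open>D(Q\<^sub>m)\<close> iff \<open>N \<le> |Q\<^sub>m|\<close>, by linear extension.
\<close>

section \<open>Homomorphisms from shift graphs and the down-set construction\<close>

text \<open>An \<open>(n+1)\<close>-set \<open>C\<close> is the arc from \<open>C - {Max C}\<close> to \<open>C - {Min C}\<close> of the shift graph on \<open>n\<close>-sets.\<close>

definition shift_hom :: "nat \<Rightarrow> nat \<Rightarrow> 'a rel \<Rightarrow> (nat set \<Rightarrow> 'a) \<Rightarrow> bool" where
  "shift_hom N n r f \<longleftrightarrow> f \<in> nsets {1..N} n \<rightarrow> Field r \<and>
     (\<forall>C\<in>nsets {1..N} (Suc n). (f (C - {Min C}), f (C - {Max C})) \<notin> r)"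

lemma nsets_remove_Min:
  fixes S :: "'a::linorder set"
  shows "C \<in> nsets S (Suc n) \<Longrightarrow> C - {Min C} \<in> nsets S n"
  using Min_in[of C] by (cases "C = {}") (auto simp: nsets_def)

lemma nsets_remove_Max:
  fixes S :: "'a::linorder set"
  shows "C \<in> nsets S (Suc n) \<Longrightarrow> C - {Max C} \<in> nsets S n"
  using Max_in[of C] by (cases "C = {}") (auto simp: nsets_def)

lemma Max_remove_Min:
  fixes C :: "'a::linorder set"
  assumes "2 \<le> card C"
  shows "Max (C - {Min C}) = Max C" "Min (C - {Max C}) = Min C" "Min C < Max C"
proof -
  have fin: "finite C" using assms card.infinite by fastforce
  have ne: "C \<noteq> {}" using assms by auto
  show lt: "Min C < Max C"
  proof (rule ccontr)
    assume "\<not> Min C < Max C"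
    then have "x = Min C" if "x \<in> C" for x
      using Min_le[OF fin that] Max_ge[OF fin that] by simp
    then have "C \<subseteq> {Min C}" by blast
    then show False using assms card_mono[of "{Min C}" C] by auto
  qed
  have "Max C \<in> C - {Min C}" "Min C \<in> C - {Max C}" using lt fin ne by auto
  then show "Max (C - {Min C}) = Max C" "Min (C - {Max C}) = Min C"
    using fin by (auto intro!: Max_eqI Min_eqI)
qed

lemma Field_J_iff: "x \<in> Field (J r) \<longleftrightarrow> (\<exists>A. x = Down A \<and> fset A \<in> down_sets r)"
  by (auto simp: Field_def J_def down_set_poset_def)

lemma Down_J_iff:
  "(Down A, Down B) \<in> J r \<longleftrightarrow> fset A \<in> down_sets r \<and> fset B \<in> down_sets r \<and> fset A \<subseteq> fset B"
  by (auto simp: J_def down_set_poset_def)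

text \<open>One half of the line digraph correspondence. \<open>g B\<close> lies in the down-set at
  the head of the arc \<open>B\<close>. If it also lay in the one at the tail, it would be below
  \<open>g A\<close> for some arc \<open>A\<close> ending where \<open>B\<close> starts, which
  \<open>g\<close> forbids for consecutive arcs.\<close>

lemma shift_hom_J_if:
  assumes "finite r" "Partial_order r" "1 \<le> n" and g: "shift_hom N (Suc n) r g"
  shows "\<exists>f. shift_hom N n (J r) f"
proof -
  \<comment> \<open>the down-set generated by the values of \<open>g\<close> on the arcs entering \<open>X\<close>\<close>
  define F where "F X = {y. \<exists>A\<in>nsets {1..N} (Suc n). A - {Min A} = X \<and> (y, g A) \<in> r}" for X
  have tr: "trans r" and rf: "refl_on (Field r) r"
    using assms(2) by (auto simp: order_on_defs)
  have F: "F X \<in> down_sets r" for X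
    using tr unfolding F_def down_sets_def by (auto simp: FieldI1 dest: transD)
  have fin: "finite (F X)" for X
    by (rule finite_subset[OF _ finite_Field[OF assms(1)]]) (auto simp: F_def FieldI1)
  have fs: "fset (Abs_fset (F X)) = F X" for X
    by (simp add: Abs_fset_inverse fin)
  have "shift_hom N n (J r) (\<lambda>X. Down (Abs_fset (F X)))"
    unfolding shift_hom_def
  proof (intro conjI ballI Pi_I notI)
    fix X show "Down (Abs_fset (F X)) \<in> Field (J r)"
      using F by (auto simp: Field_J_iff fs)
  next
    fix B assume B: "B \<in> nsets {1..N} (Suc n)"
      and "(Down (Abs_fset (F (B - {Min B}))), Down (Abs_fset (F (B - {Max B})))) \<in> J r"
    then have sub: "F (B - {Min B}) \<subseteq> F (B - {Max B})" by (simp add: Down_J_iff fs)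
    have "g B \<in> Field r" using g B by (auto simp: shift_hom_def)
    then have "g B \<in> F (B - {Min B})" using B rf by (auto simp: F_def refl_on_def)
    then have "g B \<in> F (B - {Max B})" using sub by blast
    then obtain A where A: "A \<in> nsets {1..N} (Suc n)" "A - {Min A} = B - {Max B}"
      "(g B, g A) \<in> r" unfolding F_def by blast
    have cA: "finite A" "card A = Suc n" "A \<subseteq> {1..N}" and cB: "finite B" "card B = Suc n" "B \<subseteq> {1..N}"
      using A(1) B by (auto simp: nsets_def)
    have mA: "Min A \<in> A" and mB: "Max B \<in> B" using cA cB by (metis Min_in Max_in card.empty nat.distinct(1))+
    have "card (A - {Min A}) = n" using cA mA by simp
    \<comment> \<open>\<open>1 \<le> n\<close> makes the overlap of \<open>A\<close> and
      \<open>B\<close> nonempty; an element of it separates \<open>Min A\<close> from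
      \<open>Max B\<close>.\<close>
    then have "A - {Min A} \<noteq> {}" using \<open>1 \<le> n\<close> by (metis card.empty not_one_le_zero)
    then obtain z where z: "z \<in> A - {Min A}" by blast
    have "Min A < z" using z cA by (metis Diff_iff Min_le insertCI order_le_neq_trans)
    moreover have "z \<in> B - {Max B}" using z A(2) by simp
    then have "z < Max B" using cB by (metis Diff_iff Max_ge insertCI order_le_neq_trans)
    ultimately have lt: "Min A < Max B" by simp
    \<comment> \<open>\<open>C\<close> is the \<open>(n+2)\<close>-set that, as an arc of the next
      shift graph, leads from \<open>A\<close> to \<open>B\<close>.\<close>
    define C where "C = insert (Min A) B"
    have le: "Min A < b" if "b \<in> B" for b
    proof (cases "b = Max B")
      case False
      then have "b \<in> A - {Min A}" using that A(2) by auto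
      then show ?thesis using cA by (metis Diff_iff Min_le insertCI order_le_neq_trans)
    qed (use lt in simp)
    then have nin: "Min A \<notin> B" by auto
    have C: "C \<in> nsets {1..N} (Suc (Suc n))"
      using cB nin cA mA by (auto simp: C_def nsets_def)
    have "Min C = Min A" unfolding C_def using cB le by (intro Min_eqI) (auto intro: less_imp_le)
    then have "C - {Min C} = B" using nin by (auto simp: C_def)
    moreover have "Max C = Max B" unfolding C_def using cB lt mB by (intro Max_eqI) auto
    then have "C - {Max C} = insert (Min A) (B - {Max B})" using lt by (auto simp: C_def)
    then have "C - {Max C} = A" using A(2) mA by auto
    ultimately show False using g C A(3) unfolding shift_hom_def by auto
  qed
  then show ?thesis by blast
qed

text \<open>The other half: along an arc the down-set at the head is not contained in the one at the
  tail, and \<open>g\<close> picks an element of the difference. For consecutive arcs, the down-set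
  at the shared vertex contains the first value but not the second, so the second cannot be below
  the first.\<close>

lemma shift_hom_Suc_if:
  assumes "1 \<le> n" and F: "shift_hom N n (J r) F"
  shows "\<exists>g. shift_hom N (Suc n) r g"
proof -
  \<comment> \<open>The \<open>case\<close> is unspecified on \<open>Chain\<close>, but on
    \<open>n\<close>-sets the values of \<open>F\<close> lie in \<open>Field (J r)\<close> and hence
    have the form \<open>Down A\<close>.\<close>
  define D where "D X = fset (case F X of Down A \<Rightarrow> A)" for X
  have D: "F X = Down (Abs_fset (D X))" "D X \<in> down_sets r" if "X \<in> nsets {1..N} n" for X
  proof -
    have "F X \<in> Field (J r)" using F that by (auto simp: shift_hom_def)
    then show "F X = Down (Abs_fset (D X))" "D X \<in> down_sets r"
      by (auto simp: Field_J_iff D_def fset_inverse)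
  qed
  have fs: "fset (Abs_fset (D X)) = D X" for X by (simp add: D_def fset_inverse)
  define g where "g A = (SOME x. x \<in> D (A - {Min A}) \<and> x \<notin> D (A - {Max A}))" for A
  have g: "g A \<in> D (A - {Min A}) \<and> g A \<notin> D (A - {Max A})" if A: "A \<in> nsets {1..N} (Suc n)" for A
  proof -
    have "(F (A - {Min A}), F (A - {Max A})) \<notin> J r" using F A by (auto simp: shift_hom_def)
    then have "\<not> D (A - {Min A}) \<subseteq> D (A - {Max A})"
      using D[OF nsets_remove_Min[OF A]] D[OF nsets_remove_Max[OF A]] by (auto simp: Down_J_iff fs)
    then have "\<exists>x. x \<in> D (A - {Min A}) \<and> x \<notin> D (A - {Max A})" by blast
    then show ?thesis unfolding g_def by (rule someI_ex)
  qed
  have "shift_hom N (Suc n) r g"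
    unfolding shift_hom_def
  proof (intro conjI ballI Pi_I notI)
    fix A assume A: "A \<in> nsets {1..N} (Suc n)"
    have "g A \<in> D (A - {Min A})" using g[OF A] by simp
    moreover have "D (A - {Min A}) \<subseteq> Field r"
      using D(2)[OF nsets_remove_Min[OF A]] by (simp add: down_sets_def)
    ultimately show "g A \<in> Field r" by blast
  next
    fix C assume C: "C \<in> nsets {1..N} (Suc (Suc n))"
      and le: "(g (C - {Min C}), g (C - {Max C})) \<in> r"
    let ?A = "C - {Max C}" and ?B = "C - {Min C}"
    have A: "?A \<in> nsets {1..N} (Suc n)" and B: "?B \<in> nsets {1..N} (Suc n)"
      using C nsets_remove_Max nsets_remove_Min by blast+
    have "card C \<ge> 2" using C by (auto simp: nsets_def)
    note Max_remove_Min(1,2)[OF this]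
    \<comment> \<open>This common set is the head of the arc \<open>?A\<close> and the tail of the
      arc \<open>?B\<close>.\<close>
    then have eq: "?B - {Max ?B} = ?A - {Min ?A}" by auto
    have "g ?A \<in> D (?A - {Min ?A})" "g ?B \<notin> D (?A - {Min ?A})" using g[OF A] g[OF B] eq by auto
    moreover have "\<forall>x y. y \<in> D (?A - {Min ?A}) \<longrightarrow> (x, y) \<in> r \<longrightarrow> x \<in> D (?A - {Min ?A})"
      using D(2)[OF nsets_remove_Min[OF A]] by (simp add: down_sets_def)
    ultimately show False using le by blast
  qed
  then show ?thesis by blast
qed

text \<open>Sorting by the size of the principal down-set works: passing to a strictly smaller
  element shrinks that set strictly, so distinct elements with equal keys are incomparable.\<close>

lemma ex_linear_extension:
  assumes "finite r" "Partial_order r"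
  shows "\<exists>h. bij_betw h {..<card (Field r)} (Field r) \<and>
    (\<forall>i j. i < j \<longrightarrow> j < card (Field r) \<longrightarrow> (h j, h i) \<notin> r)"
proof -
  define key where "key x = card {y. (y, x) \<in> r}" for x
  have fin: "finite (Field r)" using assms(1) by (rule finite_Field)
  obtain ys where ys: "set ys = Field r" "distinct ys" using fin finite_distinct_list by blast
  define xs where "xs = sort_key key ys"
  have xs: "set xs = Field r" "distinct xs" "length xs = card (Field r)" "sorted (map key xs)"
    using ys distinct_card[of ys] by (auto simp: xs_def)
  have keyless: "key y < key x" if "(y, x) \<in> r" "x \<noteq> y" for x y
    unfolding key_def
  proof (rule psubset_card_mono)
    show "finite {y. (y, x) \<in> r}"
      by (rule finite_subset[OF _ fin]) (auto simp: FieldI1)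
    have "(x, x) \<in> r" "(x, y) \<notin> r" and tr: "trans r"
      using assms(2) that by (auto simp: order_on_defs refl_on_def antisym_def FieldI2)
    then show "{z. (z, y) \<in> r} \<subset> {z. (z, x) \<in> r}"
      using that by (auto dest: transD)
  qed
  have "(xs ! j, xs ! i) \<notin> r" if "i < j" "j < card (Field r)" for i j
  proof
    assume "(xs ! j, xs ! i) \<in> r"
    moreover have "xs ! i \<noteq> xs ! j" using xs that by (simp add: nth_eq_iff_index_eq)
    ultimately have "key (xs ! j) < key (xs ! i)" by (rule keyless)
    moreover have "key (xs ! i) \<le> key (xs ! j)"
      using sorted_nth_mono[OF xs(4), of i j] xs(3) that by simp
    ultimately show False by simp
  qed
  moreover have "bij_betw ((!) xs) {..<card (Field r)} (Field r)"
    by (rule bij_betw_nth) (use xs in auto)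
  ultimately show ?thesis by blast
qed

text \<open>On singletons the shift graph is the transitive tournament. Reflexivity of
  \<open>r\<close> makes every homomorphism injective; conversely a linear extension supplies
  one.\<close>

lemma shift_hom_1_iff:
  assumes "finite r" "Partial_order r"
  shows "(\<exists>f. shift_hom N 1 r f) \<longleftrightarrow> N \<le> card (Field r)"
proof
  assume "\<exists>f. shift_hom N 1 r f"
  then obtain f where f: "shift_hom N 1 r f" by blast
  have fF: "f {x} \<in> Field r" if "x \<in> {1..N}" for x
    using f that by (auto simp: shift_hom_def nsets_def)
  have ne: "f {x} \<noteq> f {y}" if "x \<in> {1..N}" "y \<in> {1..N}" "x < y" for x y
  proof
    assume "f {x} = f {y}"
    have "{x, y} \<in> nsets {1..N} (Suc 1)" using that by (auto simp: nsets_def)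
    moreover have "{x, y} - {Min {x, y}} = {y}" "{x, y} - {Max {x, y}} = {x}" using that by auto
    ultimately have "(f {y}, f {x}) \<notin> r" using f unfolding shift_hom_def by metis
    then show False
      using \<open>f {x} = f {y}\<close> fF[OF that(1)] assms(2) by (auto simp: order_on_defs refl_on_def)
  qed
  have "inj_on (\<lambda>x. f {x}) {1..N}"
    by (rule inj_onI) (metis ne linorder_neqE_nat)
  then have "card {1..N} \<le> card (Field r)"
    by (rule card_inj_on_le) (use fF finite_Field[OF assms(1)] in auto)
  then show "N \<le> card (Field r)" by simp
next
  assume N: "N \<le> card (Field r)"
  obtain h where h: "bij_betw h {..<card (Field r)} (Field r)"
    "\<And>i j. i < j \<Longrightarrow> j < card (Field r) \<Longrightarrow> (h j, h i) \<notin> r"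
    using ex_linear_extension[OF assms] by blast
  have "shift_hom N 1 r (\<lambda>X. h (Min X - 1))"
    unfolding shift_hom_def
  proof (intro conjI ballI Pi_I)
    fix X assume "X \<in> nsets {1..N} 1"
    then obtain x where "X = {x}" "x \<in> {1..N}" by (auto simp: nsets_def card_Suc_eq)
    then show "h (Min X - 1) \<in> Field r" using N h(1) by (auto simp: bij_betw_def)
  next
    fix C assume "C \<in> nsets {1..N} (Suc 1)"
    then have "C \<subseteq> {1..N}" "card C = 2" by (auto simp: nsets_def)
    then obtain a b where ab: "C = {a, b}" "a \<noteq> b" by (auto simp: card_2_iff)
    obtain x y where "C = {x, y}" "x < y"
    proof (cases "a < b")
      case True
      then show ?thesis using ab that by blast
    next
      case False
      then show ?thesis using ab that[of b a] by (simp add: insert_commute)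
    qed
    then have "C - {Min C} = {y}" "C - {Max C} = {x}" by auto
    moreover have "x \<in> {1..N}" "y \<in> {1..N}" using \<open>C = {x, y}\<close> \<open>C \<subseteq> {1..N}\<close> by auto
    then have "(h (y - 1), h (x - 1)) \<notin> r" using N \<open>x < y\<close> by (intro h(2)) auto
    ultimately show "(h (Min (C - {Min C}) - 1), h (Min (C - {Max C}) - 1)) \<notin> r" by simp
  qed
  then show "\<exists>f. shift_hom N 1 r f" by blast
qed

text \<open>Each induction step trades one element of the sets for one application of
  \<open>J\<close>, so the starting index \<open>i\<close> has to be general.\<close>

lemma shift_hom_Q_iff:
  assumes "1 \<le> m"
  shows "(\<exists>f. shift_hom N m (Q 1 t e) f) \<longleftrightarrow> N \<le> card (Field (Q m t e))"
proof -
  have "(\<exists>f. shift_hom N (Suc n) (Q i t e) f) \<longleftrightarrow> N \<le> card (Field (Q (i + n) t e))"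
    if "1 \<le> i" for n i
    using that
  proof (induction n arbitrary: i)
    case 0
    then show ?case using shift_hom_1_iff[OF finite_Q Partial_order_Q] by simp
  next
    case (Suc n)
    have "(\<exists>f. shift_hom N (Suc (Suc n)) (Q i t e) f) \<longleftrightarrow> (\<exists>f. shift_hom N (Suc n) (Q (i + 1) t e) f)"
      using shift_hom_J_if[OF finite_Q Partial_order_Q] shift_hom_Suc_if
      unfolding Q_Suc[OF Suc.prems] by (metis le_add1 plus_1_eq_Suc)
    then show ?case using Suc.IH[of "i + 1"] by simp
  qed
  from this[of 1 "m - 1"] show ?thesis using assms by simp
qed

section \<open>Colourings without monochromatic tight paths as homomorphisms\<close>

text \<open>Here \<open>a\<close> is the number of edges, and vertices and edges of the path are indexed from 0.\<close>

definition tight_path :: "(nat set \<Rightarrow> nat) \<Rightarrow> nat \<Rightarrow> nat \<Rightarrow> nat \<Rightarrow> nat \<Rightarrow> (nat \<Rightarrow> nat) \<Rightarrow> bool" where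
  "tight_path c N m j a v \<longleftrightarrow> strict_mono_on {..<a + m - 1} v \<and> v \<in> {..<a + m - 1} \<rightarrow> {1..N} \<and>
     (\<forall>r<a. c (v ` {r..<r + m}) = j)"

lemma window_in_nsets:
  fixes v :: "nat \<Rightarrow> nat"
  assumes "strict_mono_on {..<b} v" "v \<in> {..<b} \<rightarrow> S" "r + m \<le> b"
  shows "v ` {r..<r + m} \<in> nsets S m"
proof -
  have "inj_on v {r..<r + m}"
    using strict_mono_on_imp_inj_on[OF assms(1)] by (rule inj_on_subset) (use assms(3) in auto)
  then show ?thesis using assms(2,3) by (auto simp: nsets_def card_image)
qed

text \<open>Consecutive windows of a tight path are thus the tail and the head of an arc of the
  shift graph.\<close>

lemma window_remove:
  fixes v :: "nat \<Rightarrow> nat"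
  assumes v: "strict_mono_on {..<b} v" and "r + m < b"
  shows "v ` {r..<r + Suc m} - {Min (v ` {r..<r + Suc m})} = v ` {Suc r..<Suc r + m}"
    and "v ` {r..<r + Suc m} - {Max (v ` {r..<r + Suc m})} = v ` {r..<r + m}"
proof -
  have inj: "inj_on v {r..<r + Suc m}"
    using strict_mono_on_imp_inj_on[OF v] by (rule inj_on_subset) (use assms(2) in auto)
  have mono: "v x \<le> v y" if "x \<le> y" "y < b" for x y
    using strict_mono_onD[OF v, of x y] that by (cases "x = y") auto
  have "Min (v ` {r..<r + Suc m}) = v r" by (rule Min_eqI) (use mono assms(2) in auto)
  moreover have "{r..<r + Suc m} - {r} = {Suc r..<Suc r + m}" by auto
  ultimately show "v ` {r..<r + Suc m} - {Min (v ` {r..<r + Suc m})} = v ` {Suc r..<Suc r + m}"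
    using inj_on_image_set_diff[OF inj, of "{r..<r + Suc m}" "{r}"] by auto
  have "Max (v ` {r..<r + Suc m}) = v (r + m)" by (rule Max_eqI) (use mono assms(2) in auto)
  moreover have "{r..<r + Suc m} - {r + m} = {r..<r + m}" by auto
  ultimately show "v ` {r..<r + Suc m} - {Max (v ` {r..<r + Suc m})} = v ` {r..<r + m}"
    using inj_on_image_set_diff[OF inj, of "{r..<r + Suc m}" "{r + m}"] by auto
qed

text \<open>A set is coloured by the chain that contains its image. Windows of one colour lie in one
  chain, where failing to be below means being strictly higher; after \<open>e j\<close> windows the
  height would exceed the chain size \<open>e j - 1\<close>.\<close>

lemma no_tight_path_if_shift_hom:
  assumes "1 \<le> m" and f: "shift_hom N m (disjoint_chains t e) f" and "\<And>j. j \<in> {1..t} \<Longrightarrow> 1 \<le> e j"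
  shows "\<exists>c\<in>nsets {1..N} m \<rightarrow> {1..t}. \<forall>j\<in>{1..t}. \<nexists>v. tight_path c N m j (e j) v"
proof -
  define c where "c X = (case f X of Chain i a \<Rightarrow> i)" for X
  define ht where "ht X = (case f X of Chain i a \<Rightarrow> a)" for X
  have f': "f X = Chain (c X) (ht X)" "c X \<in> {1..t}" "1 \<le> ht X" "ht X \<le> e (c X) - 1"
    if "X \<in> nsets {1..N} m" for X
  proof -
    have "f X \<in> Field (disjoint_chains t e)" using f that by (auto simp: shift_hom_def)
    then show "f X = Chain (c X) (ht X)" "c X \<in> {1..t}" "1 \<le> ht X" "ht X \<le> e (c X) - 1"
      unfolding Field_def c_def ht_def disjoint_chains_def by auto
  qed
  have "\<nexists>v. tight_path c N m j (e j) v" if j: "j \<in> {1..t}" for j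
  proof
    assume "\<exists>v. tight_path c N m j (e j) v"
    then obtain v where v: "strict_mono_on {..<e j + m - 1} v" "v \<in> {..<e j + m - 1} \<rightarrow> {1..N}"
      "\<And>r. r < e j \<Longrightarrow> c (v ` {r..<r + m}) = j" by (auto simp: tight_path_def)
    have win: "v ` {r..<r + m} \<in> nsets {1..N} m" if "r < e j" for r
      by (rule window_in_nsets[OF v(1,2)]) (use that in auto)
    have "r < ht (v ` {r..<r + m})" if "r < e j" for r
      using that
    proof (induction r)
      case 0
      then show ?case using f'(3)[OF win[of 0]] by simp
    next
      case (Suc r)
      let ?C = "v ` {r..<r + Suc m}"
      have "?C \<in> nsets {1..N} (Suc m)"
        by (rule window_in_nsets[OF v(1,2)]) (use Suc.prems in auto)
      then have "(f (?C - {Min ?C}), f (?C - {Max ?C})) \<notin> disjoint_chains t e"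
        using f unfolding shift_hom_def by blast
      moreover have "r + m < e j + m - 1" using Suc.prems by simp
      note window_remove[OF v(1) this]
      ultimately have *: "(f (v ` {Suc r..<Suc r + m}), f (v ` {r..<r + m})) \<notin> disjoint_chains t e"
        by simp
      have r: "r < e j" using Suc.prems by simp
      have "\<not> ht (v ` {Suc r..<Suc r + m}) \<le> ht (v ` {r..<r + m})"
      proof
        assume "ht (v ` {Suc r..<Suc r + m}) \<le> ht (v ` {r..<r + m})"
        moreover have "ht (v ` {r..<r + m}) \<le> e j - 1" using f'(4)[OF win[OF r]] v(3)[OF r] by simp
        ultimately have "(Chain j (ht (v ` {Suc r..<Suc r + m})), Chain j (ht (v ` {r..<r + m}))) \<in> disjoint_chains t e"
          using f'(3)[OF win[OF Suc.prems]] j unfolding disjoint_chains_def by auto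
        then show False
          using * f'(1)[OF win[OF Suc.prems]] f'(1)[OF win[OF r]] v(3)[OF r] v(3)[OF Suc.prems] by simp
      qed
      then show ?case using Suc.IH[OF r] by simp
    qed
    note this[of "e j - 1"]
    moreover have lt: "e j - 1 < e j" using assms(3)[OF j] by simp
    moreover note f'(4)[OF win[OF lt]] v(3)[OF lt]
    ultimately show False by simp
  qed
  then show ?thesis using f'(2) by blast
qed

text \<open>A set goes to its colour and the greatest length of a monochromatic tight path ending in
  it. If the head of an arc were sent weakly below the tail, a longest path ending in the tail could
  be extended to the head, a contradiction.\<close>

lemma shift_hom_if_no_tight_path:
  assumes m: "1 \<le> m" and c: "c \<in> nsets {1..N} m \<rightarrow> {1..t}"
    and no: "\<And>j v. j \<in> {1..t} \<Longrightarrow> \<not> tight_path c N m j (e j) v"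
  shows "\<exists>f. shift_hom N m (disjoint_chains t e) f"
proof -
  \<comment> \<open>The window at \<open>a - 1\<close> is the last of \<open>a\<close> edges;
    \<open>1 \<le> a\<close> rules out the edgeless path, for which \<open>a - 1\<close> would be
    truncated to 0.\<close>
  define reach where "reach A a \<longleftrightarrow>
    (\<exists>v. 1 \<le> a \<and> tight_path c N m (c A) a v \<and> v ` {a - 1..<a - 1 + m} = A)" for A a
  define f where "f A = Chain (c A) (Max (Collect (reach A)))" for A
  have less: "a < e (c A)" if "A \<in> nsets {1..N} m" and re: "reach A a" for A a
  proof (rule ccontr)
    assume "\<not> a < e (c A)"
    moreover obtain v where "tight_path c N m (c A) a v" using re by (auto simp: reach_def)
    \<comment> \<open>A path that is too long is cut down to its first \<open>e (c A)\<close>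
      edges.\<close>
    moreover from calculation(1) have "{..<e (c A) + m - 1} \<subseteq> {..<a + m - 1}" by auto
    ultimately have "tight_path c N m (c A) (e (c A)) v"
      unfolding tight_path_def by (auto elim: monotone_on_subset)
    moreover have "c A \<in> {1..t}" using c that by auto
    ultimately show False using no by blast
  qed
  have fin: "finite (Collect (reach A))" if "A \<in> nsets {1..N} m" for A
    by (rule finite_subset[of _ "{..<e (c A)}"]) (use less that in auto)
  have one: "reach A 1" if A: "A \<in> nsets {1..N} m" for A
  proof -
    have A': "finite A" "card A = m" "A \<subseteq> {1..N}" using A by (auto simp: nsets_def)
    obtain h where h: "bij_betw h {..<m} A" "strict_mono_on {..<m} h"
      using ex_bij_betw_strict_mono_card[OF A'(1)] A'(2) by metis
    have "h ` {0..<m} = A" using h(1) by (auto simp: bij_betw_def lessThan_atLeast0)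
    then have "tight_path c N m (c A) 1 h" using h A' by (auto simp: tight_path_def)
    then show ?thesis using \<open>h ` {0..<m} = A\<close> by (auto simp: reach_def)
  qed
  have "shift_hom N m (disjoint_chains t e) f"
    unfolding shift_hom_def
  proof (intro conjI ballI Pi_I notI)
    fix A assume A: "A \<in> nsets {1..N} m"
    let ?M = "Max (Collect (reach A))"
    have "?M \<in> Collect (reach A)" by (rule Max_in) (use fin[OF A] one[OF A] in auto)
    then have "?M < e (c A)" "1 \<le> ?M" using less[OF A] by (auto simp: reach_def)
    then have "(f A, f A) \<in> disjoint_chains t e"
      using c A by (auto simp: f_def disjoint_chains_def)
    then show "f A \<in> Field (disjoint_chains t e)" by (rule FieldI1)
  next
    fix C assume C: "C \<in> nsets {1..N} (Suc m)"
      and le: "(f (C - {Min C}), f (C - {Max C})) \<in> disjoint_chains t e"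
    define A where "A = C - {Max C}"
    define B where "B = C - {Min C}"
    have A: "A \<in> nsets {1..N} m" and B: "B \<in> nsets {1..N} m"
      using C nsets_remove_Max nsets_remove_Min unfolding A_def B_def by blast+
    have C': "finite C" "card C = Suc m" "C \<subseteq> {1..N}" using C by (auto simp: nsets_def)
    have MC: "Max C \<in> C" "Min C \<in> C" using C' by (metis Max_in Min_in card.empty nat.distinct(1))+
    \<comment> \<open>Comparable elements lie in the same chain, so both sets have the same
      colour.\<close>
    from le have ceq: "c B = c A" and ler: "Max (Collect (reach B)) \<le> Max (Collect (reach A))"
      unfolding f_def disjoint_chains_def A_def B_def by auto
    define a where "a = Max (Collect (reach A))"
    have "a \<in> Collect (reach A)" unfolding a_def by (rule Max_in) (use fin[OF A] one[OF A] in auto)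
    then obtain v where a: "1 \<le> a" and v: "tight_path c N m (c A) a v"
      and vA: "v ` {a - 1..<a - 1 + m} = A" by (auto simp: reach_def)
    have sm: "strict_mono_on {..<a + m - 1} v" and vN: "v \<in> {..<a + m - 1} \<rightarrow> {1..N}"
      and col: "\<And>r. r < a \<Longrightarrow> c (v ` {r..<r + m}) = c A"
      using v by (auto simp: tight_path_def)
    \<comment> \<open>The longest path ending in \<open>A\<close> is extended by the one vertex of
      \<open>C\<close> missing from \<open>A\<close>, so that its new last window is
      \<open>B\<close>.\<close>
    define w where "w = v(a + m - 1 := Max C)"
    have last: "v i < Max C" if "i < a + m - 1" for i
    proof -
      have "a + m - 2 \<in> {a - 1..<a - 1 + m}" using a m by auto
      then have "v (a + m - 2) \<in> A" using vA by blast
      then have "v (a + m - 2) < Max C" using C' unfolding A_def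
        by (metis Diff_iff Max_ge insertCI order_le_neq_trans)
      moreover have "v i \<le> v (a + m - 2)"
      proof (cases "i < a + m - 2")
        case True
        then have "v i < v (a + m - 2)"
          by (intro strict_mono_onD[OF sm]) (use a m in auto)
        then show ?thesis by simp
      next
        case False
        then have "i = a + m - 2" using that by linarith
        then show ?thesis by simp
      qed
      ultimately show ?thesis by simp
    qed
    have wsm: "strict_mono_on {..<Suc (a + m - 1)} w"
      unfolding w_def
      by (rule strict_mono_onI) (use last strict_mono_onD[OF sm] in \<open>auto simp: less_Suc_eq\<close>)
    have wN: "w \<in> {..<Suc (a + m - 1)} \<rightarrow> {1..N}" 
    proof
      fix i assume "i \<in> {..<Suc (a + m - 1)}"
      moreover have "Max C \<in> {1..N}" using MC(1) C'(3) by blast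
      ultimately show "w i \<in> {1..N}" using vN unfolding w_def Pi_iff by (cases "i = a + m - 1") auto
    qed
    have old: "w ` {r..<r + m} = v ` {r..<r + m}" if "r < a" for r
      using that by (intro image_cong) (auto simp: w_def)
    have "w ` {a - 1..<a - 1 + Suc m} = insert (w (a - 1 + m)) (w ` {a - 1..<a - 1 + m})"
      by (simp add: atLeastLessThanSuc)
    also have "\<dots> = insert (Max C) A" using old[of "a - 1"] a vA by (simp add: w_def)
    also have "\<dots> = C" using MC by (auto simp: A_def)
    finally have wC: "w ` {a - 1..<a - 1 + Suc m} = C" .
    have "a - 1 + m < Suc (a + m - 1)" using a by simp
    from window_remove(1)[OF wsm this] have wB: "w ` {a..<a + m} = B"
      unfolding wC using a by (simp add: B_def)
    have "c (w ` {r..<r + m}) = c B" if "r < Suc a" for r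
    proof (cases "r = a")
      case False
      then show ?thesis using that old[of r] col[of r] ceq by simp
    qed (use wB in simp)
    then have "tight_path c N m (c B) (Suc a) w"
      using wsm wN a unfolding tight_path_def by (simp add: Suc_diff_le)
    then have "reach B (Suc a)" using wB by (auto simp: reach_def)
    then have "Suc a \<le> Max (Collect (reach B))" using fin[OF B] by (intro Max_ge) auto
    then show False using ler by (simp add: a_def)
  qed
  then show ?thesis by blast
qed

lemma tight_path_coloring_iff:
  assumes "1 \<le> m" and "\<And>j. j \<in> {1..t} \<Longrightarrow> 1 \<le> e j"
  shows "(\<exists>c\<in>nsets {1..N} m \<rightarrow> {1..t}. \<forall>j\<in>{1..t}. \<nexists>v. tight_path c N m j (e j) v) \<longleftrightarrow>
    N \<le> card (Field (Q m t e))"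
    (is "?L \<longleftrightarrow> _")
proof -
  have "?L \<longleftrightarrow> (\<exists>f. shift_hom N m (disjoint_chains t e) f)"
  proof
    assume ?L
    then obtain c where "c \<in> nsets {1..N} m \<rightarrow> {1..t}"
      "\<And>j v. j \<in> {1..t} \<Longrightarrow> \<not> tight_path c N m j (e j) v" by blast
    then show "\<exists>f. shift_hom N m (disjoint_chains t e) f"
      by (rule shift_hom_if_no_tight_path[OF assms(1)])
  next
    assume "\<exists>f. shift_hom N m (disjoint_chains t e) f"
    then obtain f where "shift_hom N m (disjoint_chains t e) f" by blast
    then show ?L by (rule no_tight_path_if_shift_hom[OF assms(1) _ assms(2)])
  qed
  then show ?thesis using shift_hom_Q_iff[OF assms(1), of N t e] unfolding Q_1 by (rule trans)
qed

section \<open>The path index, and paths as increasing sequences\<close>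

text \<open>Clearing denominators shows that the index is \<open>k / (k - l)\<close> rounded up.
  Uniqueness follows by chaining the lower bound for one candidate with the upper bound for the
  other.\<close>

lemma path_index_eq:
  assumes "l < k" "2 \<le> m" "(m - 1) * (k - l) < k" "k \<le> m * (k - l)"
  shows "path_index k l = m"
proof -
  have cond: "(real n - 2) / (real n - 1) < real l / real k \<and> real l / real k \<le> (real n - 1) / real n
      \<longleftrightarrow> (n - 1) * (k - l) < k \<and> k \<le> n * (k - l)" if n: "2 \<le> n" for n
  proof -
    have r: "real ((n - 1) * (k - l)) = (real n - 1) * (real k - real l)"
      "real (n * (k - l)) = real n * (real k - real l)"
      using n assms(1) by (simp_all add: of_nat_diff)
    have "(real n - 2) / (real n - 1) < real l / real k \<longleftrightarrow> (real n - 2) * real k < real l * (real n - 1)"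
      using n assms(1) by (simp add: divide_less_eq less_divide_eq field_simps)
    also have "\<dots> \<longleftrightarrow> real ((n - 1) * (k - l)) < real k" unfolding r by (simp add: algebra_simps)
    finally have 1: "(real n - 2) / (real n - 1) < real l / real k \<longleftrightarrow> (n - 1) * (k - l) < k"
      by (simp only: of_nat_less_iff)
    have "real l / real k \<le> (real n - 1) / real n \<longleftrightarrow> real l * real n \<le> (real n - 1) * real k"
      using n assms(1) by (simp add: field_simps)
    also have "\<dots> \<longleftrightarrow> real k \<le> real (n * (k - l))" unfolding r by (simp add: algebra_simps)
    finally have 2: "real l / real k \<le> (real n - 1) / real n \<longleftrightarrow> k \<le> n * (k - l)"
      by (simp only: of_nat_le_iff)
    show ?thesis using 1 2 by simp
  qed
  show ?thesis unfolding path_index_def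
  proof (rule the_equality)
    show "2 \<le> m \<and> (real m - 2) / (real m - 1) < real l / real k \<and> real l / real k \<le> (real m - 1) / real m"
      using cond assms by simp
  next
    fix n assume n: "2 \<le> n \<and> (real n - 2) / (real n - 1) < real l / real k
      \<and> real l / real k \<le> (real n - 1) / real n"
    then have n': "(n - 1) * (k - l) < k" "k \<le> n * (k - l)" using cond by auto
    have "(n - 1) * (k - l) < m * (k - l)" "(m - 1) * (k - l) < n * (k - l)"
      using n' assms by linarith+
    then show "n = m" using n assms(2) by (simp only: mult_less_cancel2) linarith
  qed
qed

text \<open>Injective and monotone together mean strictly increasing, and the images of edges are
  then automatically \<open>k\<close>-sets. Edges are renumbered from 0 to match
  \<open>tight_path\<close>.\<close>

lemma contained_in_color_class_iff:
  assumes "l < k"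
  shows "contained_in (path_hypergraph k l a) (color_class (complete_hypergraph k N) c j) \<longleftrightarrow>
    (\<exists>u. strict_mono_on {1..a * (k - l) + l} u \<and> u \<in> {1..a * (k - l) + l} \<rightarrow> {1..N} \<and>
      (\<forall>r<a. c (u ` {r * (k - l) + 1..r * (k - l) + k}) = j))"
    (is "?L \<longleftrightarrow> (\<exists>u. ?P u)")
proof -
  let ?V = "{1..a * (k - l) + l}"
  have edges: "(\<forall>A\<in>path_edge k l ` {1..a}. R A) \<longleftrightarrow> (\<forall>r<a. R {r * (k - l) + 1..r * (k - l) + k})" for R
  proof -
    have "{1..a} = Suc ` {..<a}" by (simp add: image_Suc_lessThan)
    then have "path_edge k l ` {1..a} = (\<lambda>r. {r * (k - l) + 1..r * (k - l) + k}) ` {..<a}"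
      by (simp only: image_image path_edge_def diff_Suc_1)
    then show ?thesis by auto
  qed
  have sub: "{r * (k - l) + 1..r * (k - l) + k} \<subseteq> ?V" if "r < a" for r
  proof -
    have "Suc r * (k - l) \<le> a * (k - l)" using that by (intro mult_le_mono1) simp
    then show ?thesis using assms by auto
  qed
  show ?thesis
  proof
    assume ?L
    then obtain u where u: "u \<in> ?V \<rightarrow> {1..N}" "inj_on u ?V" "mono_on ?V u"
      and col: "\<forall>A\<in>path_edge k l ` {1..a}. u ` A \<in> {A \<in> nsets {1..N} k. c A = j}"
      unfolding contained_in_def path_hypergraph_def color_class_def complete_hypergraph_def
        hypergraph.simps by blast
    have "strict_mono_on ?V u"
    proof (rule strict_mono_onI)
      fix x y assume xy: "x \<in> ?V" "y \<in> ?V" "x < y"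
      have "u x \<le> u y" using monotone_onD[OF u(3) xy(1,2)] xy(3) by simp
      moreover have "u x \<noteq> u y" using inj_onD[OF u(2) _ xy(1,2)] xy(3) by auto
      ultimately show "u x < u y" by simp
    qed
    moreover have "\<forall>r<a. c (u ` {r * (k - l) + 1..r * (k - l) + k}) = j"
      using col unfolding edges by blast
    ultimately show "\<exists>u. ?P u" using u(1) by blast
  next
    assume "\<exists>u. ?P u"
    then obtain u where u: "?P u" by blast
    then have inj: "inj_on u ?V" and mono: "mono_on ?V u"
      using strict_mono_on_imp_inj_on strict_mono_on_imp_mono_on by blast+
    have "u ` {r * (k - l) + 1..r * (k - l) + k} \<in> {A \<in> nsets {1..N} k. c A = j}" if "r < a" for r
    proof -
      have "u ` {r * (k - l) + 1..r * (k - l) + k} \<subseteq> {1..N}" using u sub[OF that] by blast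
      moreover have "card (u ` {r * (k - l) + 1..r * (k - l) + k}) = k"
        using card_image[OF inj_on_subset[OF inj sub[OF that]]] by simp
      ultimately show ?thesis using u that by (auto simp: nsets_def)
    qed
    then have "\<forall>A\<in>path_edge k l ` {1..a}. u ` A \<in> {A \<in> nsets {1..N} k. c A = j}"
      unfolding edges by blast
    then show ?L using u inj mono
      unfolding contained_in_def path_hypergraph_def color_class_def complete_hypergraph_def
        hypergraph.simps by blast
  qed
qed

section \<open>Blowing up tight paths\<close>

text \<open>Vertex \<open>Suc y\<close> has offset \<open>y mod d\<close> in block number
  \<open>Suc (y div d)\<close>. Only the block of the maximum is truncated, so an
  \<open>m\<close>-set of positive numbers yields \<open>(m - 1) * d + s\<close> vertices.\<close>

definition blow_up :: "nat \<Rightarrow> nat \<Rightarrow> nat set \<Rightarrow> nat set" where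
  "blow_up d s X = {Suc y | y. Suc (y div d) \<in> X \<and> (Suc (y div d) = Max X \<longrightarrow> y mod d < s)}"

text \<open>The full blocks of \<open>v 0\<close>, \<open>v 1\<close>, ... are listed in turn, with
  positions \<open>p\<close> counted from 1; truncation comes only from restricting the range of
  \<open>p\<close>.\<close>

definition blow_up_seq :: "nat \<Rightarrow> (nat \<Rightarrow> nat) \<Rightarrow> nat \<Rightarrow> nat" where
  "blow_up_seq d v p = Suc ((v ((p - 1) div d) - 1) * d + (p - 1) mod d)"

text \<open>Moving the window by one vertex moves the positions by one block of \<open>d\<close>.
  The positions run out after \<open>s\<close> entries of the window's last block, which is exactly
  the truncation at the maximum.\<close>

lemma blow_up_window:
  assumes v: "strict_mono_on {..<b} v" "v \<in> {..<b} \<rightarrow> {1..}"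
    and "1 \<le> m" "r + m \<le> b" "s \<le> d" "1 \<le> s"
  shows "blow_up d s (v ` {r..<r + m}) = blow_up_seq d v ` {r * d + 1..r * d + ((m - 1) * d + s)}"
proof -
  let ?X = "v ` {r..<r + m}"
  have d: "0 < d" using assms by simp
  have vpos: "1 \<le> v i" if "i < b" for i using v(2) that by auto
  have M: "Max ?X = v (r + m - 1)"
  proof (rule Max_eqI)
    fix y assume "y \<in> ?X"
    then obtain i where i: "i \<in> {r..<r + m}" "y = v i" by blast
    show "y \<le> v (r + m - 1)"
    proof (cases "i < r + m - 1")
      case True
      then have "v i < v (r + m - 1)"
        by (intro strict_mono_onD[OF v(1)]) (use assms(3,4) in auto)
      then show ?thesis using i(2) by simp
    next
      case False
      then have "i = r + m - 1" using i(1) by auto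
      then show ?thesis using i(2) by simp
    qed
  qed (use assms in auto)
  have Mi: "v i = Max ?X \<longleftrightarrow> i = r + m - 1" if "i \<in> {r..<r + m}" for i
    unfolding M using inj_onD[OF strict_mono_on_imp_inj_on[OF v(1)]] that assms(4) by auto
  have last: "(r + m - 1) * d = r * d + (m - 1) * d"
    using assms(3) by (simp flip: add_mult_distrib)
  show ?thesis
  proof (intro equalityI subsetI)
    fix x assume "x \<in> blow_up d s ?X"
    then obtain y i where x: "x = Suc y" and i: "i \<in> {r..<r + m}" "Suc (y div d) = v i"
      and y: "Suc (y div d) = Max ?X \<longrightarrow> y mod d < s" by (auto simp: blow_up_def)
    \<comment> \<open>The position at which \<open>x\<close> is listed: same offset, in the block
      with index \<open>i\<close>.\<close>
    let ?p = "Suc (i * d + y mod d)"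
    have "r * d \<le> i * d" using i by simp
    moreover have "i * d + y mod d < r * d + ((m - 1) * d + s)"
    proof (cases "i = r + m - 1")
      case True
      then have "y mod d < s" using Mi[OF i(1)] i(2) y by simp
      then show ?thesis using True last by simp
    next
      case False
      then have "Suc i * d \<le> (r + m - 1) * d" using i by (intro mult_le_mono1) auto
      then show ?thesis using last mod_less_divisor[OF d, of y] assms(6) unfolding mult_Suc by linarith
    qed
    ultimately have "?p \<in> {r * d + 1..r * d + ((m - 1) * d + s)}"
      unfolding atLeastAtMost_iff by linarith
    moreover have "v i - 1 = y div d" using i(2) by simp
    then have "blow_up_seq d v ?p = x" using d by (simp add: blow_up_seq_def x)
    ultimately show "x \<in> blow_up_seq d v ` {r * d + 1..r * d + ((m - 1) * d + s)}" by blast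
  next
    fix x assume "x \<in> blow_up_seq d v ` {r * d + 1..r * d + ((m - 1) * d + s)}"
    then obtain p where p: "p \<in> {r * d + 1..r * d + ((m - 1) * d + s)}" "x = blow_up_seq d v p" by blast
    define i where "i = (p - 1) div d"
    define y where "y = (v i - 1) * d + (p - 1) mod d"
    have pd: "p - 1 = i * d + (p - 1) mod d" by (simp add: i_def)
    have p1: "r * d \<le> p - 1" "p - 1 < (r + m - 1) * d + s" using p(1) last by auto
    have "r \<le> i" using div_le_mono[OF p1(1), of d] d by (simp add: i_def)
    moreover have "p - 1 < (r + m) * d"
    proof -
      have "(r + m) * d = (r + m - 1) * d + d"
        using assms(3) by (cases m) simp_all
      then show ?thesis using p1(2) assms(5) by linarith
    qed
    then have "i < r + m" unfolding i_def by (simp add: less_mult_imp_div_less)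
    ultimately have i: "i \<in> {r..<r + m}" by simp
    have yd: "y div d = v i - 1" "y mod d = (p - 1) mod d" using d by (simp_all add: y_def)
    then have "Suc (y div d) = v i" using vpos[of i] i assms(4) by simp
    moreover have "y mod d < s" if "v i = Max ?X"
      using Mi[OF i] that p1(2) pd yd(2) by simp
    moreover have "x = Suc y" by (simp add: p(2) blow_up_seq_def y_def i_def)
    ultimately show "x \<in> blow_up d s ?X" using i by (auto simp: blow_up_def)
  qed
qed

lemma strict_mono_on_blow_up_seq:
  assumes v: "strict_mono_on {..<b} v" "v \<in> {..<b} \<rightarrow> {1..}" and d: "0 < d"
  shows "strict_mono_on {1..b * d} (blow_up_seq d v)"
proof (rule strict_mono_onI)
  fix p q assume pq: "p \<in> {1..b * d}" "q \<in> {1..b * d}" "p < q"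
  let ?i = "(p - 1) div d" and ?j = "(q - 1) div d"
  have lt: "?j < b" using pq by (intro less_mult_imp_div_less) auto
  have le: "?i \<le> ?j" using pq by (intro div_le_mono) auto
  show "blow_up_seq d v p < blow_up_seq d v q"
  proof (cases "?i = ?j")
    case True
    then have "(p - 1) mod d < (q - 1) mod d"
      using pq div_mult_mod_eq[of "p - 1" d] div_mult_mod_eq[of "q - 1" d]
      by (metis atLeastAtMost_iff diff_less_mono nat_add_left_cancel_less)
    then show ?thesis using True by (simp add: blow_up_seq_def)
  next
    case False
    then have "v ?i < v ?j" using strict_mono_onD[OF v(1), of ?i ?j] le lt by auto
    moreover have "1 \<le> v ?i" using v(2) le lt by auto
    ultimately have "Suc (v ?i - 1) * d \<le> (v ?j - 1) * d" by (intro mult_le_mono1) simp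
    then show ?thesis using mod_less_divisor[OF d, of "p - 1"] unfolding blow_up_seq_def mult_Suc by linarith
  qed
qed

text \<open>Only block \<open>Suc q\<close> could overshoot. By strict monotonicity it can occur
  only at the last index \<open>b - 1\<close>, where the bound on \<open>p\<close> leaves offsets
  below \<open>s\<close>.\<close>

lemma blow_up_seq_le:
  assumes v: "strict_mono_on {..<b} v" "v \<in> {..<b} \<rightarrow> {1..Suc q}" and d: "0 < d"
    and p: "1 \<le> p" "p \<le> (b - 1) * d + s" "p \<le> b * d"
  shows "blow_up_seq d v p \<le> q * d + s"
proof -
  let ?i = "(p - 1) div d"
  have lt: "?i < b" using p by (intro less_mult_imp_div_less) auto
  have pd: "p - 1 = ?i * d + (p - 1) mod d" by simp
  show ?thesis
  proof (cases "v ?i \<le> q \<and> 1 \<le> v ?i")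
    case True
    then have "Suc (v ?i - 1) * d \<le> q * d" by (intro mult_le_mono1) simp
    then show ?thesis using mod_less_divisor[OF d, of "p - 1"] unfolding blow_up_seq_def mult_Suc by linarith
  next
    case False
    then have vi: "v ?i = Suc q" using v(2) lt by (force simp: le_Suc_eq)
    have "?i = b - 1"
    proof (rule ccontr)
      assume "?i \<noteq> b - 1"
      then have "v ?i < v (b - 1)" using strict_mono_onD[OF v(1), of ?i "b - 1"] lt by auto
      moreover have "v (b - 1) \<le> Suc q" using v(2) lt by auto
      ultimately show False using vi by simp
    qed
    then have "(p - 1) mod d < s" using pd p by auto
    then show ?thesis using vi by (simp add: blow_up_seq_def)
  qed
qed

section \<open>Sampling tight paths from paths\<close>

text \<open>Every \<open>d\<close>-th element is taken in increasing order, starting from the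
  \<open>s\<close>-th, and is replaced by its block number, where blocks of length \<open>d\<close>
  start at the vertex \<open>s\<close>.\<close>

definition sample :: "nat \<Rightarrow> nat \<Rightarrow> nat \<Rightarrow> nat set \<Rightarrow> nat set" where
  "sample d s m A = (\<lambda>i. Suc ((sorted_list_of_set A ! (s - 1 + i * d) - s) div d)) ` {..<m}"

definition sample_seq :: "nat \<Rightarrow> nat \<Rightarrow> (nat \<Rightarrow> nat) \<Rightarrow> nat \<Rightarrow> nat" where
  "sample_seq d s u i = Suc ((u (s + i * d) - s) div d)"

lemma nth_sorted_list_of_image:
  fixes u :: "nat \<Rightarrow> 'a::linorder"
  assumes "strict_mono_on {p + 1..p + k} u" "i < k"
  shows "sorted_list_of_set (u ` {p + 1..p + k}) ! i = u (p + 1 + i)"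
proof -
  have "sorted_wrt (<) (map u [p + 1..<p + k + 1])"
    by (auto simp: sorted_wrt_iff_nth_less simp del: upt_Suc intro!: strict_mono_onD[OF assms(1)])
  moreover have "set (map u [p + 1..<p + k + 1]) = u ` {p + 1..p + k}"
    by (simp add: atLeastLessThanSuc_atLeastAtMost del: upt_Suc)
  ultimately have "sorted_list_of_set (u ` {p + 1..p + k}) = map u [p + 1..<p + k + 1]"
    by (metis sorted_list_of_set.idem_if_sorted_distinct strict_sorted_iff)
  then show ?thesis using assms(2) by (simp del: upt_Suc)
qed

text \<open>Shifting an edge by \<open>d\<close> positions shifts the picked positions by
  \<open>d\<close>, so consecutive edges give consecutive windows of a single sequence.\<close>

lemma sample_window:
  assumes "strict_mono_on {1..n} u" "r * d + ((m - 1) * d + s) \<le> n" "1 \<le> s"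
  shows "sample d s m (u ` {r * d + 1..r * d + ((m - 1) * d + s)}) = sample_seq d s u ` {r..<r + m}"
proof -
  have sm: "strict_mono_on {r * d + 1..r * d + ((m - 1) * d + s)} u"
    by (rule monotone_on_subset[OF assms(1)]) (use assms(2) in auto)
  have "sorted_list_of_set (u ` {r * d + 1..r * d + ((m - 1) * d + s)}) ! (s - 1 + i * d)
      = u (s + (r + i) * d)" if "i < m" for i
  proof -
    have "i * d \<le> (m - 1) * d" using that by (intro mult_le_mono1) simp
    then have "s - 1 + i * d < (m - 1) * d + s" using assms(3) by linarith
    note nth_sorted_list_of_image[OF sm this]
    moreover have "r * d + 1 + (s - 1 + i * d) = s + (r + i) * d"
      using assms(3) unfolding add_mult_distrib by linarith
    ultimately show ?thesis by simp
  qed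
  then have "sample d s m (u ` {r * d + 1..r * d + ((m - 1) * d + s)})
      = (\<lambda>i. sample_seq d s u (r + i)) ` {..<m}"
    unfolding sample_def sample_seq_def by (intro image_cong) auto
  also have "\<dots> = sample_seq d s u ` ((+) r ` {..<m})" by (simp add: image_image)
  also have "(+) r ` {..<m} = {r..<r + m}" by (simp add: lessThan_atLeast0 add.commute)
  finally show ?thesis .
qed

lemma strict_mono_on_add_le:
  fixes u :: "nat \<Rightarrow> nat"
  assumes "strict_mono_on {1..n} u" "1 \<le> p" "p + i \<le> n"
  shows "u p + i \<le> u (p + i)"
  using assms(3)
proof (induction i)
  case (Suc i)
  then show ?case using strict_mono_onD[OF assms(1), of "p + i" "p + Suc i"] assms(2) by auto
qed simp

text \<open>Positions \<open>d\<close> apart carry vertices at least \<open>d\<close> apart, so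
  block numbers increase strictly; \<open>N < q * d + s\<close> leaves only \<open>q\<close>
  blocks.\<close>

lemma sample_seq_props:
  assumes u: "strict_mono_on {1..(b - 1) * d + s} u" "u \<in> {1..(b - 1) * d + s} \<rightarrow> {1..N}"
    and "1 \<le> s" "0 < d" "N < q * d + s"
  shows "strict_mono_on {..<b} (sample_seq d s u)" "sample_seq d s u \<in> {..<b} \<rightarrow> {1..q}"
proof -
  have le: "s + i * d \<le> (b - 1) * d + s" if "i < b" for i
  proof -
    have "i * d \<le> (b - 1) * d" using that by (intro mult_le_mono1) simp
    then show ?thesis by simp
  qed
  \<comment> \<open>This keeps the truncated subtraction of \<open>s\<close> exact.\<close>
  have big: "s \<le> u (s + i * d)" if "i < b" for i
  proof -
    have n: "1 + (s - 1 + i * d) = s + i * d" using assms(3) by simp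
    have "1 \<in> {1..(b - 1) * d + s}" using assms(3) by simp
    then have "1 \<le> u 1" using u(2) by auto
    moreover have "u 1 + (s - 1 + i * d) \<le> u (s + i * d)"
      using strict_mono_on_add_le[OF u(1), of 1 "s - 1 + i * d"] le[OF that] unfolding n by simp
    ultimately show ?thesis by simp
  qed
  show "strict_mono_on {..<b} (sample_seq d s u)"
  proof (rule strict_mono_onI)
    fix i j assume ij: "i \<in> {..<b}" "j \<in> {..<b}" "i < j"
    then have "Suc i * d \<le> j * d" by (intro mult_le_mono1) simp
    then obtain z where z: "j * d = i * d + d + z" by (auto simp: le_iff_add)
    have "u (s + i * d) + (d + z) \<le> u (s + i * d + (d + z))"
      using strict_mono_on_add_le[OF u(1), of "s + i * d" "d + z"] le[of j] ij assms(3) z by simp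
    then have "u (s + i * d) + d \<le> u (s + j * d)" using z by (simp add: algebra_simps)
    then have "(u (s + i * d) - s) + d \<le> u (s + j * d) - s" using big[of i] ij by simp
    then have "(u (s + i * d) - s + d) div d \<le> (u (s + j * d) - s) div d" by (rule div_le_mono)
    then show "sample_seq d s u i < sample_seq d s u j"
      using assms(4) by (simp add: sample_seq_def)
  qed
  show "sample_seq d s u \<in> {..<b} \<rightarrow> {1..q}"
  proof
    fix i assume i: "i \<in> {..<b}"
    have "s + i * d \<in> {1..(b - 1) * d + s}" using le[of i] i assms(3) by simp
    then have "u (s + i * d) \<le> N" using u(2) by auto
    then have "u (s + i * d) - s < q * d" using assms(5) big[of i] i by simp
    then show "sample_seq d s u i \<in> {1..q}" by (simp add: sample_seq_def less_mult_imp_div_less Suc_le_eq)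
  qed
qed

section \<open>Transfer between the two path problems\<close>

lemma ex_enumeration:
  fixes A :: "nat set"
  assumes "A \<in> nsets S n"
  obtains h where "strict_mono_on {..<n} h" "h ` {..<n} = A"
proof -
  have "finite A" "card A = n" using assms by (auto simp: nsets_def)
  then show ?thesis
    using ex_bij_betw_strict_mono_card[of A] that by (metis bij_betw_imp_surj_on)
qed

theorem theorem4:
  fixes k l t :: nat and e :: "nat \<Rightarrow> nat"
  assumes "1 \<le> l" and "l < k" and "1 \<le> t" and "\<And>j. j \<in> {1..t} \<Longrightarrow> 1 \<le> e j"
  shows "int (ordered_ramsey_number k t (\<lambda>j. path_hypergraph k l (e j))) =
           (int k - int l) * int (card (Field (Q (path_index k l) t e))) + int l
             - (int k - int l) * (int (path_index k l) - 2)"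
proof -
  define d where "d = k - l"
  \<comment> \<open>Dividing \<open>k - 1\<close> instead of \<open>k\<close> puts the remainder
    part \<open>s\<close> into the range from 1 to \<open>d\<close>.\<close>
  define m where "m = Suc ((k - 1) div d)"
  define s where "s = Suc ((k - 1) mod d)"
  have d: "0 < d" "d < k" using assms by (auto simp: d_def)
  have s: "1 \<le> s" "s \<le> d" using d by (auto simp: s_def Suc_le_eq)
  have k: "k = (m - 1) * d + s" using d by (simp add: m_def s_def)
  have m: "2 \<le> m" using k s d by (cases "m - 1") auto
  have msplit: "m * d = (m - 1) * d + d" using m by (cases m) auto
  have l: "l = (m - 2) * d + s"
  proof -
    have "m - 1 = Suc (m - 2)" using m by simp
    then have "(m - 1) * d = (m - 2) * d + d" by (simp only: mult_Suc add.commute)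
    moreover have "k = d + l" using assms(2) by (simp add: d_def)
    ultimately show ?thesis using k by linarith
  qed
  have pi: "path_index k l = m"
  proof (rule path_index_eq[OF assms(2) m])
    show "(m - 1) * (k - l) < k" "k \<le> m * (k - l)"
      unfolding d_def[symmetric] using k s msplit by linarith+
  qed
  define q where "q = card (Field (Q m t e))"
  \<comment> \<open>A tight path with \<open>a\<close> edges has \<open>a + m - 1\<close> vertices;
    all of their blocks but the last are full, hence the further \<open>- 1\<close>.\<close>
  have len: "a * d + l = (a + m - 1 - 1) * d + s" for a
  proof -
    have "a + m - 1 - 1 = a + (m - 2)" using m by simp
    then show ?thesis by (simp add: l add_mult_distrib)
  qed
  have contained: "contained_in (path_hypergraph k l a) (color_class (complete_hypergraph k N) c j) \<longleftrightarrow>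
    (\<exists>u. strict_mono_on {1..(a + m - 1 - 1) * d + s} u \<and> u \<in> {1..(a + m - 1 - 1) * d + s} \<rightarrow> {1..N} \<and>
      (\<forall>r<a. c (u ` {r * d + 1..r * d + ((m - 1) * d + s)}) = j))" for a N c j
    using contained_in_color_class_iff[OF assms(2), of a N c j] unfolding d_def[symmetric] len k[symmetric] .
  let ?P = "\<lambda>N. \<forall>c \<in> edges (complete_hypergraph k N) \<rightarrow> {1..t}.
        \<exists>j\<in>{1..t}. contained_in (path_hypergraph k l (e j)) (color_class (complete_hypergraph k N) c j)"
  have edges: "edges (complete_hypergraph k N) = nsets {1..N} k" for N
    by (simp add: complete_hypergraph_def)
  note tight = tight_path_coloring_iff[of m t e, OF _ assms(4), folded q_def]
  have "(LEAST N. ?P N) = q * d + s"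
  proof (rule Least_equality)
    \<comment> \<open>Upper bound: \<open>c\<close> is pulled back along \<open>blow_up\<close> to
      the \<open>m\<close>-subsets of \<open>{1..Suc q}\<close>, where a monochromatic tight path
      must exist; its blow-up is the required path.\<close>
    show "?P (q * d + s)"
    proof
      fix c assume "c \<in> edges (complete_hypergraph k (q * d + s)) \<rightarrow> {1..t}"
      then have c: "c \<in> nsets {1..q * d + s} k \<rightarrow> {1..t}" by (simp add: edges)
      have seq: "strict_mono_on {1..(b - 1) * d + s} (blow_up_seq d v)"
        "blow_up_seq d v \<in> {1..(b - 1) * d + s} \<rightarrow> {1..q * d + s}"
        if v: "strict_mono_on {..<b} v" "v \<in> {..<b} \<rightarrow> {1..Suc q}" and "1 \<le> b" for b v
      proof -
        have "b * d = (b - 1) * d + d" using \<open>1 \<le> b\<close> by (cases b) auto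
        then have le: "(b - 1) * d + s \<le> b * d" using s by simp
        have "v \<in> {..<b} \<rightarrow> {1..}" using v(2) by auto
        from strict_mono_on_blow_up_seq[OF v(1) this d(1)]
        show "strict_mono_on {1..(b - 1) * d + s} (blow_up_seq d v)"
          by (rule monotone_on_subset) (use le in auto)
        show "blow_up_seq d v \<in> {1..(b - 1) * d + s} \<rightarrow> {1..q * d + s}"
        proof
          fix p assume "p \<in> {1..(b - 1) * d + s}"
          then have "blow_up_seq d v p \<le> q * d + s"
            using le by (intro blow_up_seq_le[OF v d(1)]) auto
          then show "blow_up_seq d v p \<in> {1..q * d + s}" by (simp add: blow_up_seq_def)
        qed
      qed
      \<comment> \<open>The pulled-back colouring must have values in \<open>{1..t}\<close>. For
        this, \<open>X\<close> is viewed as the window \<open>r = 0\<close> of its own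
        enumeration.\<close>
      have "c (blow_up d s X) \<in> {1..t}" if X: "X \<in> nsets {1..Suc q} m" for X
      proof -
        obtain h where h: "strict_mono_on {..<m} h" "h ` {..<m} = X" using ex_enumeration[OF X] .
        have hX: "h \<in> {..<m} \<rightarrow> {1..Suc q}" using h(2) X by (auto simp: nsets_def)
        then have "h \<in> {..<m} \<rightarrow> {1..}" by auto
        from blow_up_window[OF h(1) this, of m 0 s d] m s h(2)
        have eq: "blow_up d s X = blow_up_seq d h ` {1..(m - 1) * d + s}"
          by (simp add: lessThan_atLeast0)
        have "1 \<le> m" using m by simp
        note hs = seq[OF h(1) hX this]
        have "card (blow_up d s X) = k"
          unfolding eq using card_image[OF strict_mono_on_imp_inj_on[OF hs(1)]] k by simp
        then have "blow_up d s X \<in> nsets {1..q * d + s} k"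
          unfolding eq using hs(2) by (auto simp: nsets_def)
        then show ?thesis using c by blast
      qed
      then have "(\<lambda>X. c (blow_up d s X)) \<in> nsets {1..Suc q} m \<rightarrow> {1..t}" by blast
      moreover have "1 \<le> m" using m by simp
      ultimately obtain j v where j: "j \<in> {1..t}"
        and "tight_path (\<lambda>X. c (blow_up d s X)) (Suc q) m j (e j) v"
        using tight[of "Suc q"] by auto
      then have v: "strict_mono_on {..<e j + m - 1} v" "v \<in> {..<e j + m - 1} \<rightarrow> {1..Suc q}"
        "\<And>r. r < e j \<Longrightarrow> c (blow_up d s (v ` {r..<r + m})) = j"
        by (auto simp: tight_path_def)
      have v1: "v \<in> {..<e j + m - 1} \<rightarrow> {1..}" using v(2) by auto
      have "c (blow_up_seq d v ` {r * d + 1..r * d + ((m - 1) * d + s)}) = j" if "r < e j" for r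
        using v(3)[OF that] blow_up_window[OF v(1) v1, of m r s d] that m s by simp
      moreover have "1 \<le> e j + m - 1" using m by simp
      ultimately show "\<exists>j\<in>{1..t}. contained_in (path_hypergraph k l (e j))
          (color_class (complete_hypergraph k (q * d + s)) c j)"
        using seq[OF v(1,2)] j unfolding contained by blast
    qed
  next
    fix N assume N: "?P N"
    \<comment> \<open>Lower bound: a colouring of the \<open>m\<close>-subsets of
      \<open>{1..q}\<close> without the tight paths is pulled back along \<open>sample\<close>; a
      monochromatic path for it would sample to a forbidden tight path.\<close>
    show "q * d + s \<le> N"
    proof (rule ccontr)
      assume "\<not> q * d + s \<le> N"
      then have less: "N < q * d + s" by simp
      obtain c where c: "c \<in> nsets {1..q} m \<rightarrow> {1..t}"
        and no: "\<And>j v. j \<in> {1..t} \<Longrightarrow> \<not> tight_path c q m j (e j) v"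
        using tight[of q] m by auto
      have "c (sample d s m A) \<in> {1..t}" if A: "A \<in> nsets {1..N} k" for A
      proof -
        obtain h where h: "strict_mono_on {..<k} h" "h ` {..<k} = A" using ex_enumeration[OF A] .
        define u where "u p = h (p - 1)" for p
        have u: "strict_mono_on {1..(m - 1) * d + s} u"
          by (rule strict_mono_onI) (use k in \<open>auto simp: u_def intro!: strict_mono_onD[OF h(1)]\<close>)
        have "u ` {1..k} = h ` ((\<lambda>p. p - 1) ` {1..k})" by (simp add: u_def image_image)
        also have "(\<lambda>p. p - 1) ` {1..k} = {..<k}" by force
        finally have uA: "u ` {1..(m - 1) * d + s} = A" using h(2) k by simp
        then have uN: "u \<in> {1..(m - 1) * d + s} \<rightarrow> {1..N}" using A by (auto simp: nsets_def)
        have "sample d s m A = sample_seq d s u ` {0..<m}"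
          using sample_window[OF u, of 0 d m s] s uA by simp
        moreover have "sample_seq d s u ` {0..<0 + m} \<in> nsets {1..q} m"
          by (rule window_in_nsets[OF sample_seq_props[OF u uN s(1) d(1) less]]) simp
        ultimately show ?thesis using c by auto
      qed
      then have "(\<lambda>A. c (sample d s m A)) \<in> edges (complete_hypergraph k N) \<rightarrow> {1..t}"
        by (auto simp: edges)
      then obtain j where j: "j \<in> {1..t}" and "contained_in (path_hypergraph k l (e j))
          (color_class (complete_hypergraph k N) (\<lambda>A. c (sample d s m A)) j)" using N by blast
      then obtain u where u: "strict_mono_on {1..(e j + m - 1 - 1) * d + s} u"
        "u \<in> {1..(e j + m - 1 - 1) * d + s} \<rightarrow> {1..N}"
        and col: "\<And>r. r < e j \<Longrightarrow> c (sample d s m (u ` {r * d + 1..r * d + ((m - 1) * d + s)})) = j"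
        unfolding contained by blast
      have "c (sample_seq d s u ` {r..<r + m}) = j" if "r < e j" for r
      proof -
        have "(r + (m - 1)) * d \<le> (e j + m - 1 - 1) * d" using that m by (intro mult_le_mono1) simp
        then have "r * d + ((m - 1) * d + s) \<le> (e j + m - 1 - 1) * d + s"
          unfolding add_mult_distrib by linarith
        from sample_window[OF u(1) this s(1)] col[OF that] show ?thesis by simp
      qed
      then have "tight_path c q m j (e j) (sample_seq d s u)"
        using sample_seq_props[OF u s(1) d(1) less] by (simp add: tight_path_def)
      then show False using no[OF j] by blast
    qed
  qed
  then have R: "ordered_ramsey_number k t (\<lambda>j. path_hypergraph k l (e j)) = q * d + s"
    unfolding ordered_ramsey_number_def .
  have kl: "int k - int l = int d" using assms(2) by (simp add: d_def)
  \<comment> \<open>With this value of \<open>l\<close> the claimed right-hand side collapses to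
    \<open>q * d + s\<close>.\<close>
  have "int l = int d * (int m - 2) + int s" using l m by (simp add: of_nat_diff)
  then show ?thesis unfolding R pi kl q_def[symmetric] by (simp add: algebra_simps)
qed

end
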